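(* Let $G$ be a connected graph and let $\mathcal Y$ be a principal collection of vertex sets of $G$. Then there exists a strongly admissible function for $\mathcal Y$.
   Context: For vertex sets $X,Y$ of $G$, $\mathcal C_X$ denotes the set of components of $G-X$ and $\check{\mathcal C}_X$ the set of those $C\in\mathcal C_X$ with neighbourhood $N(C)=X$. Given a collection $\mathcal Y$ of vertex sets, a vertex set $X$ is $\mathcal Y$-principal if for every $Y\in\mathcal Y$ it meets at most one component of $G-Y$; $\mathcal Y$ is principal if all its elements are $\mathcal Y$-principal. If $X$ meets exactly one component of $G-Y$, that component is denoted $C_Y(X)$ (so for $X,Y$ in a principal collection with $X\not\subseteq Y$, $C_Y(X)$ is defined). A function $\mathcal K$ assigning to every $X\in\mathcal Y$ a subset $\mathcal K(X)\subseteq\check{\mathcal C}_X$ is admissible for $\mathcal Y$ if for every two $X,Y\in\mathcal Y$ that are incomparable as sets, $C_X(Y)\notin\mathcal K(X)$ or $C_Y(X)\notin\mathcal K(Y)$; it is strongly admissible if moreover $|\check{\mathcal C}_X\setminus\mathcal K(X)|\le1$ for all $X\in\mathcal Y$. *)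

theory Defs
  imports "Graph_Theory.Digraph_Component"
begin

text \<open>
  Graphs are simple, undirected and possibly infinite. Following the Graph_Theory entry, such a
  graph is a symmetric loop-free digraph (locale \<^term>\<open>pair_bidirected_digraph\<close>) whose arcs are
  ordered pairs of vertices; neither the graph nor the vertex sets below need be finite.
  The definitions only make sense for symmetric digraphs.
\<close>

text \<open>
  The components of \<open>G - X\<close>, each given by its vertex set. In a symmetric digraph the strongly
  connected components are the connected components; they are nonempty by definition.
\<close>

definition comps :: "('a, 'b) pre_digraph \<Rightarrow> 'a set \<Rightarrow> 'a set set" where
  "comps G X = pre_digraph.sccs_verts (G \<restriction> (verts G - X))"

definition nbhd :: "('a, 'b) pre_digraph \<Rightarrow> 'a set \<Rightarrow> 'a set" where
  "nbhd G C = {v \<in> verts G - C. \<exists>u\<in>C. u \<rightarrow>\<^bsub>G\<^esub> v}"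

definition full_comps :: "('a, 'b) pre_digraph \<Rightarrow> 'a set \<Rightarrow> 'a set set" where
  "full_comps G X = {C \<in> comps G X. nbhd G C = X}"

definition principal_set :: "('a, 'b) pre_digraph \<Rightarrow> 'a set set \<Rightarrow> 'a set \<Rightarrow> bool" where
  "principal_set G \<Y> X \<longleftrightarrow>
     (\<forall>Y\<in>\<Y>. \<forall>C\<in>comps G Y. \<forall>D\<in>comps G Y. X \<inter> C \<noteq> {} \<and> X \<inter> D \<noteq> {} \<longrightarrow> C = D)"

definition principal :: "('a, 'b) pre_digraph \<Rightarrow> 'a set set \<Rightarrow> bool" where
  "principal G \<Y> \<longleftrightarrow> (\<forall>X\<in>\<Y>. principal_set G \<Y> X)"

text \<open>
  \<open>comp_of G Y X\<close> is \<open>C\<^sub>Y(X)\<close>; it is meaningful only if \<open>X\<close> meets exactly one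
  component of \<open>G - Y\<close>, e.g. if \<open>X\<close> and \<open>Y\<close> lie in a principal collection of subsets of
  \<open>verts G\<close> and \<open>X\<close> is not a subset of \<open>Y\<close>.
\<close>

definition comp_of :: "('a, 'b) pre_digraph \<Rightarrow> 'a set \<Rightarrow> 'a set \<Rightarrow> 'a set" where
  "comp_of G Y X = (THE C. C \<in> comps G Y \<and> X \<inter> C \<noteq> {})"

text \<open>Functions on \<open>\<Y>\<close> are total functions whose values outside \<open>\<Y>\<close> are irrelevant.\<close>

definition admissible ::
  "('a, 'b) pre_digraph \<Rightarrow> 'a set set \<Rightarrow> ('a set \<Rightarrow> 'a set set) \<Rightarrow> bool" where
  "admissible G \<Y> K \<longleftrightarrow>
     (\<forall>X\<in>\<Y>. K X \<subseteq> full_comps G X) \<and>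
     (\<forall>X\<in>\<Y>. \<forall>Y\<in>\<Y>. \<not> X \<subseteq> Y \<and> \<not> Y \<subseteq> X \<longrightarrow>
        comp_of G X Y \<notin> K X \<or> comp_of G Y X \<notin> K Y)"

definition strongly_admissible ::
  "('a, 'b) pre_digraph \<Rightarrow> 'a set set \<Rightarrow> ('a set \<Rightarrow> 'a set set) \<Rightarrow> bool" where
  "strongly_admissible G \<Y> K \<longleftrightarrow>
     admissible G \<Y> K \<and>
     (\<forall>X\<in>\<Y>. finite (full_comps G X - K X) \<and> card (full_comps G X - K X) \<le> 1)"

end

theory Submission
  imports Defs
begin

text \<open>
  Fix a well-order of the vertices and let \<open>r X\<close> be the least vertex lying in some full component
  of \<open>G - X\<close>; \<open>\<K> X\<close> consists of the full components avoiding \<open>r X\<close>.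
  Let \<open>X\<close>, \<open>Y\<close> be incomparable with \<open>C\<^sub>X(Y) \<in> \<K> X\<close> and \<open>C\<^sub>Y(X) \<in> \<K> Y\<close>. The full component of
  \<open>G - X\<close> containing \<open>r X\<close> is not \<open>C\<^sub>X(Y)\<close>, so it avoids \<open>Y\<close>; as its neighbourhood is all of \<open>X\<close>,
  it lies inside \<open>C\<^sub>Y(X)\<close>. Hence \<open>r X \<in> C\<^sub>Y(X)\<close> and so \<open>r Y \<le> r X\<close>. By symmetry \<open>r X = r Y\<close>,
  contradicting \<open>r Y \<notin> C\<^sub>Y(X)\<close>.
\<close>

text \<open>\<open>R\<close> is a well-order of the whole type and \<open>m\<close> its minimum
  operator; minimality and antisymmetry are what the later comparison of least vertices
  uses.\<close>

lemma ex_least_choice: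
  "\<exists>(R :: 'a rel) m. antisym R \<and> (\<forall>A. \<forall>a\<in>A. m A \<in> A \<and> (m A, a) \<in> R)"
proof -
  obtain R :: "'a rel" where R: "Well_order R" "Field R = UNIV"
    using well_ordering by (elim exE conjE)
  then have wo: "wo_rel R" by (simp add: wo_rel_def)
  have "wo_rel.minim R A \<in> A \<and> (wo_rel.minim R A, a) \<in> R" if "a \<in> A" for A a
    using wo_rel.minim_in[OF wo, of A] wo_rel.minim_least[OF wo, of A a] that R(2) by auto
  with wo_rel.ANTISYM[OF wo] show ?thesis
    by (intro exI[of _ R] exI[of _ "wo_rel.minim R"]) simp
qed

context wf_digraph
begin

lemma comps_subset: "C \<in> comps G X \<Longrightarrow> C \<subseteq> verts G - X"
  using wf_digraph.sccs_verts_subsets[OF wellformed_induce_subgraph]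
  by (fastforce simp: comps_def)

lemma comps_eqI:
  assumes "C \<in> comps G X" "D \<in> comps G X" "v \<in> C" "v \<in> D"
  shows "C = D"
  using assms wf_digraph.sccs_verts_disjoint[OF wellformed_induce_subgraph]
  unfolding comps_def by blast

lemma comps_cover:
  assumes "v \<in> verts G - X"
  obtains C where "C \<in> comps G X" "v \<in> C"
proof -
  interpret H: wf_digraph "G \<restriction> (verts G - X)" ..
  show thesis
    using that[of "H.scc_of v"] assms H.scc_of_in_sccs_verts H.in_scc_of_self
    by (simp add: comps_def)
qed

text \<open>Any vertex of \<open>X - Y\<close> lies in some component of \<open>G - Y\<close>, and
  principality makes that the only component met by \<open>X\<close>; so the definite description in
  \<open>comp_of\<close> is well defined.\<close>

lemma comp_of_props:
  assumes "principal_set G \<Y> X" "Y \<in> \<Y>" "X \<subseteq> verts G" "\<not> X \<subseteq> Y"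
  shows "comp_of G Y X \<in> comps G Y" "X - Y \<subseteq> comp_of G Y X"
proof -
  have *: "comp_of G Y X = C" if "C \<in> comps G Y" "x \<in> X" "x \<in> C" for x C
    unfolding comp_of_def using assms(1,2) that
    by (intro the_equality) (auto simp: principal_set_def)
  have "comp_of G Y X \<in> comps G Y \<and> x \<in> comp_of G Y X" if "x \<in> X - Y" for x
  proof -
    have "x \<in> verts G - Y" using that assms(3) by auto
    then obtain C where "C \<in> comps G Y" "x \<in> C" by (rule comps_cover)
    with * that show ?thesis by auto
  qed
  with assms(4) show "comp_of G Y X \<in> comps G Y" "X - Y \<subseteq> comp_of G Y X" by auto
qed

end

context sym_digraph
begin

text \<open>Since \<open>C\<close> is connected and avoids \<open>Y\<close>, it stays connected in
  \<open>G - Y\<close>, and the edge from \<open>c\<close> to \<open>d\<close> attaches it to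
  \<open>D\<close>.\<close>

lemma comps_absorb:
  assumes C: "C \<in> comps G X" "C \<inter> Y = {}"
    and D: "D \<in> comps G Y" "d \<in> D" and adj: "c \<in> C" "c \<rightarrow>\<^bsub>G\<^esub> d"
  shows "C \<subseteq> D"
proof
  fix v assume "v \<in> C"
  let ?H = "G \<restriction> (verts G - X)" and ?K = "G \<restriction> (verts G - Y)"
  interpret H: max_reachable_set ?H C
    using C(1) unfolding comps_def
    by (intro max_reachable_set.intro max_reachable_set_axioms.intro wellformed_induce_subgraph)
  interpret K: sym_digraph ?K by (rule induced_graph_imp_graph) auto
  have CX: "C \<subseteq> verts G - X" using C(1) by (rule comps_subset)
  \<comment> \<open>Restricting to \<open>C\<close> forgets \<open>X\<close>, so paths inside
    \<open>C\<close> carry over to \<open>G - Y\<close>.\<close>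
  have "?H \<restriction> C = G \<restriction> C" using CX by (auto simp: induce_subgraph_def)
  moreover have "v \<rightarrow>\<^sup>*\<^bsub>?H \<restriction> C\<^esub> c"
    using \<open>v \<in> C\<close> adj(1) by (intro H.reachable_induced H.reach_in)
  ultimately have "v \<rightarrow>\<^sup>*\<^bsub>?K\<^esub> c"
    using CX C(2) reachable_induce_ss[of C v c "verts G - Y"] by auto
  moreover have "c \<rightarrow>\<^bsub>?K\<^esub> d"
    using adj CX C(2) comps_subset[OF D(1)] D(2) by (auto simp: arcs_ends_conv)
  ultimately have "v \<rightarrow>\<^sup>*\<^bsub>?K\<^esub> d" by (rule K.reachable_adj_trans)
  \<comment> \<open>Components are strongly connected components here, so both directions are
    required.\<close>
  moreover from this have "d \<rightarrow>\<^sup>*\<^bsub>?K\<^esub> v" by (rule K.symmetric_reachable')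
  ultimately show "v \<in> D" using D by (auto simp: comps_def K.in_sccs_verts_conv_reachable)
qed

lemma full_comp_subset_comp_of:
  assumes "principal G \<Y>" "X \<in> \<Y>" "Y \<in> \<Y>" "X \<subseteq> verts G" "Y \<subseteq> verts G"
    and "\<not> X \<subseteq> Y" "\<not> Y \<subseteq> X" and C: "C \<in> full_comps G X" "C \<noteq> comp_of G X Y"
  shows "C \<subseteq> comp_of G Y X"
proof -
  have ps: "principal_set G \<Y> X" "principal_set G \<Y> Y"
    using assms by (auto simp: principal_def)
  note XY = comp_of_props[OF ps(1) \<open>Y \<in> \<Y>\<close> \<open>X \<subseteq> verts G\<close> \<open>\<not> X \<subseteq> Y\<close>]
  note YX = comp_of_props[OF ps(2) \<open>X \<in> \<Y>\<close> \<open>Y \<subseteq> verts G\<close> \<open>\<not> Y \<subseteq> X\<close>]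
  have C': "C \<in> comps G X" "nbhd G C = X" using C(1) by (auto simp: full_comps_def)
  \<comment> \<open>A vertex of \<open>C\<close> in \<open>Y\<close> would lie in
    \<open>Y - X\<close>, hence in \<open>comp_of G X Y\<close>, making the two components
    equal.\<close>
  have disj: "C \<inter> Y = {}"
    using comps_eqI[OF C'(1) YX(1)] YX(2) C(2) comps_subset[OF C'(1)] by blast
  obtain x where x: "x \<in> X" "x \<notin> Y" using \<open>\<not> X \<subseteq> Y\<close> by auto
  then obtain c where "c \<in> C" "c \<rightarrow>\<^bsub>G\<^esub> x" using C'(2) by (auto simp: nbhd_def)
  moreover have "x \<in> comp_of G Y X" using x XY(2) by auto
  ultimately show ?thesis using comps_absorb[OF C'(1) disj XY(1)] by blast
qed

theorem strongly_admissible_exists: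
  assumes sub: "\<And>Y. Y \<in> \<Y> \<Longrightarrow> Y \<subseteq> verts G" and pr: "principal G \<Y>"
  shows "\<exists>K. strongly_admissible G \<Y> K"
proof -
  obtain R :: "'a rel" and m :: "'a set \<Rightarrow> 'a" where "antisym R"
    and m: "\<forall>A. \<forall>a\<in>A. m A \<in> A \<and> (m A, a) \<in> R"
    using ex_least_choice by (elim exE conjE)
  define r where "r X = m (\<Union>(full_comps G X))" for X
  define K where "K X = {C \<in> full_comps G X. r X \<notin> C}" for X
  have r: "r X \<in> \<Union>(full_comps G X)" "(r X, v) \<in> R" if "v \<in> C" "C \<in> full_comps G X" for v C X
    using m[rule_format, OF UnionI[OF that(2,1)]] by (simp_all add: r_def)
  have K_sub: "C \<in> full_comps G X" if "C \<in> K X" for C X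
    using that by (simp add: K_def)
  have nonempty: "C \<noteq> {}" if "C \<in> full_comps G X" for C X
    using that by (simp add: full_comps_def comps_def pre_digraph.sccs_verts_def)
  have r_comp_of: "r X \<in> comp_of G Y X"
    if "X \<in> \<Y>" "Y \<in> \<Y>" "\<not> X \<subseteq> Y" "\<not> Y \<subseteq> X" "comp_of G X Y \<in> K X" for X Y
  proof -
    \<comment> \<open>This provides a full component, so \<open>r X\<close> is a genuine least
      vertex and not \<open>m\<close> of the empty set.\<close>
    have "comp_of G X Y \<in> full_comps G X" using that(5) by (simp add: K_def)
    then obtain C where "C \<in> full_comps G X" "r X \<in> C" using nonempty r(1) by blast
    moreover from this have "C \<noteq> comp_of G X Y" using that(5) by (auto simp: K_def)
    ultimately show ?thesis
      using full_comp_subset_comp_of[OF pr, of X Y C] that sub by blast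
  qed
  have "comp_of G X Y \<notin> K X \<or> comp_of G Y X \<notin> K Y"
    if XY: "X \<in> \<Y>" "Y \<in> \<Y>" "\<not> X \<subseteq> Y" "\<not> Y \<subseteq> X" for X Y
  proof (rule ccontr)
    assume "\<not> ?thesis"
    then have *: "comp_of G X Y \<in> K X" "comp_of G Y X \<in> K Y" by auto
    have rX: "r X \<in> comp_of G Y X" and rY: "r Y \<in> comp_of G X Y"
      using r_comp_of[of X Y] r_comp_of[of Y X] XY * by auto
    \<comment> \<open>\<open>comp_of G Y X\<close> is a full component of \<open>G - Y\<close>
      containing \<open>r X\<close>, which bounds the least vertex \<open>r Y\<close>; likewise with
      the roles exchanged.\<close>
    have "(r Y, r X) \<in> R" "(r X, r Y) \<in> R"
      using r(2)[OF rX] r(2)[OF rY] * K_sub by auto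
    then have "r X = r Y" by (rule antisymD[OF \<open>antisym R\<close>, rotated])
    with rX * show False by (simp add: K_def)
  qed
  moreover have "finite (full_comps G X - K X) \<and> card (full_comps G X - K X) \<le> 1" for X
  proof -
    \<comment> \<open>Every full component left out of \<open>K X\<close> contains
      \<open>r X\<close>, and distinct components are disjoint.\<close>
    have "C = D" if "C \<in> full_comps G X - K X" "D \<in> full_comps G X - K X" for C D
      using that comps_eqI[of C X D "r X"] by (simp add: K_def full_comps_def)
    then consider "full_comps G X - K X = {}" | C where "full_comps G X - K X = {C}" by blast
    then show ?thesis by cases (simp_all only: finite.emptyI card.empty, simp_all)
  qed
  ultimately have "strongly_admissible G \<Y> K"
    unfolding strongly_admissible_def admissible_def by (blast intro: K_sub)
  then show ?thesis by (rule exI[of _ K])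
qed

end

theorem theorem5p10:
  fixes G :: "'a pair_pre_digraph" and \<Y> :: "'a set set"
  assumes "pair_bidirected_digraph G"
    and "connected (with_proj G)"
    and "\<And>Y. Y \<in> \<Y> \<Longrightarrow> Y \<subseteq> pverts G"
    and "principal (with_proj G) \<Y>"
  shows "\<exists>K. strongly_admissible (with_proj G) \<Y> K"
proof -
  interpret pair_bidirected_digraph G by fact
  show ?thesis using assms by (intro strongly_admissible_exists) auto
qed

end
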